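(* As formal power series in $q$ (equivalently, for $q$ in a sufficiently small neighborhood of $0$), $$\mathcal{L}(x;q):=\sum_{n\ge 1}\Big(\sum_{k=0}^{n-1} f_n(k,n-1)x^k\Big)q^n=\frac{q(1-q)^2}{(1-2q)(1-xq)}.$$
   Context: An inversion sequence of length $n$ is a sequence $e=e_1\cdots e_n$ of integers with $0\le e_i\le i-1$. The reduction of a word replaces each occurrence of the $k$-th smallest distinct entry by $k-1$; $e$ contains a pattern $p$ if some subsequence (entries at increasing positions) has reduction $p$, and avoids $p$ otherwise. $\mathbf{I}_n(0012)$ is the set of inversion sequences of length $n$ avoiding $0012$. For $e\in\mathbf{I}_n(0012)$, $\mathcal{R}(e)$ is the set of values appearing at least twice in $e$, $\textsc{srpt}(e)=\min\mathcal{R}(e)$ with the convention $\textsc{srpt}(01\cdots(n-1))=n-1$, and $\textsc{last}(e)=e_n$. $f_n(k,\ell)$ is the number of $e\in\mathbf{I}_n(0012)$ with $\textsc{srpt}(e)=k$ and $\textsc{last}(e)=\ell$. *)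

theory Defs
  imports Main "HOL-Library.Sublist" "HOL-Computational_Algebra.Formal_Power_Series"
begin

text \<open>
  Sequences are lists, so the entry written \<open>e\<^sub>i\<close> on paper is \<open>e ! (i - 1)\<close>, and the bound
  \<open>e\<^sub>i \<le> i - 1\<close> becomes \<open>e ! i \<le> i\<close>.
\<close>

definition inversion_seq :: "nat list \<Rightarrow> bool" where
  "inversion_seq e \<longleftrightarrow> (\<forall>i < length e. e ! i \<le> i)"

text \<open>The \<open>k\<close>-th smallest distinct entry is the one with exactly \<open>k - 1\<close> distinct entries below it.\<close>

definition reduction :: "nat list \<Rightarrow> nat list" where
  "reduction w = map (\<lambda>v. card {u \<in> set w. u < v}) w"

definition contains_pattern :: "nat list \<Rightarrow> nat list \<Rightarrow> bool" where
  "contains_pattern e p \<longleftrightarrow> (\<exists>s. subseq s e \<and> reduction s = p)"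

definition I0012 :: "nat \<Rightarrow> nat list set" where
  "I0012 n = {e. length e = n \<and> inversion_seq e \<and> \<not> contains_pattern e [0, 0, 1, 2]}"

definition repeated_values :: "nat list \<Rightarrow> nat set" where
  "repeated_values e = {v. count_list e v \<ge> 2}"

text \<open>
  \<open>[0..<n]\<close> is the only inversion sequence of length \<open>n\<close> without repeated values, so the minimum
  is taken over a nonempty set whenever \<open>e\<close> is an inversion sequence.
\<close>

definition srpt :: "nat list \<Rightarrow> nat" where
  "srpt e = (if e = [0..<length e] then length e - 1 else Min (repeated_values e))"

definition f :: "nat \<Rightarrow> nat \<Rightarrow> nat \<Rightarrow> nat" where
  "f n k l = card {e \<in> I0012 n. srpt e = k \<and> last e = l}"

text \<open>
  The power series in \<open>q\<close> (which is \<open>fps_X\<close>). The parameter \<open>x\<close> ranges over an arbitrary field; the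
  case of an indeterminate is \<open>x\<close> the generator of a field of rational functions, for
  instance \<open>to_fract [:0, 1:]\<close> in \<open>rat poly fract\<close>.
\<close>

definition L :: "'a :: field \<Rightarrow> 'a fps" where
  "L x = Abs_fps (\<lambda>n. if n = 0 then 0 else (\<Sum>k = 0..n - 1. of_nat (f n k (n - 1)) * x ^ k))"

end

theory Submission imports Defs begin

text \<open>
  If \<open>e\<close> has length \<open>N + 1\<close> and last entry \<open>N\<close>, that entry exceeds all others, so \<open>e\<close> avoids
  \<open>0012\<close> iff its prefix \<open>p\<close> of length \<open>N\<close> avoids \<open>001\<close>. Such a prefix is \<open>01\<cdots>(t - 1)\<close> followed by
  a weakly decreasing word over \<open>{..<t}\<close>, so its smallest repeated value is its last entry unless
  \<open>p = 01\<cdots>(N - 1)\<close>. Deleting the last entry of \<open>p\<close> therefore shows that the number \<open>t(N, k)\<close> of these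
  \<open>e\<close> with \<open>srpt e = k\<close> satisfies \<open>t(N + 1, k) = t(N, k) + \<cdots> + t(N, N)\<close> for \<open>k < N\<close>, whence
  \<open>t(N, k)\<close> is the coefficient of \<open>q ^ (N - k)\<close> in \<open>(1 - q)\<^sup>2 / (1 - 2q)\<close>.
\<close>

section \<open>The pattern \<open>0012\<close> as an explicit subsequence\<close>

text \<open>A larger rank in the reduction forces a larger value, and two entries of rank
  \<open>0\<close> are both the minimum, hence equal.\<close>

lemma reduction_eq_0012_iff:
  "reduction s = [0,0,1,2] \<longleftrightarrow> (\<exists>a b c. s = [a,a,b,c] \<and> a < b \<and> b < c)"
proof
  assume r: "reduction s = [0,0,1,2]"
  define g where "g v = card {u \<in> set s. u < v}" for v
  have "length s = 4"
    using arg_cong[OF r, of length] by (simp add: reduction_def)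
  then obtain a a' b c where s: "s = [a,a',b,c]"
    by (auto simp: numeral_eq_Suc length_Suc_conv)
  have g: "g a = 0" "g a' = 0" "g b = 1" "g c = 2"
    using r by (simp_all add: reduction_def g_def s)
  have mono: "v < w" if "g v < g w" for v w
  proof (rule ccontr)
    assume "\<not> v < w"
    then have "g w \<le> g v"
      unfolding g_def by (intro card_mono) auto
    with that show False by simp
  qed
  have "\<not> v < w" if "g w = 0" "v \<in> set s" for v w
    using that unfolding g_def by auto
  then have "a = a'"
    using g s by (metis linorder_neqE_nat list.set_intros(1,2))
  then show "\<exists>a b c. s = [a,a,b,c] \<and> a < b \<and> b < c"
    using s g mono[of a b] mono[of b c] by auto
next
  assume "\<exists>a b c. s = [a,a,b,c] \<and> a < b \<and> b < c"
  then obtain a b c where s: "s = [a,a,b,c]" and "a < b" "b < c" by blast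
  then have "{u \<in> set s. u < a} = {}" "{u \<in> set s. u < b} = {a}" "{u \<in> set s. u < c} = {a,b}"
    by auto
  then show "reduction s = [0,0,1,2]"
    using \<open>a < b\<close> by (simp add: reduction_def s del: list.set)
qed

lemma contains_0012_iff:
  "contains_pattern e [0,0,1,2] \<longleftrightarrow> (\<exists>a b c. a < b \<and> b < c \<and> subseq [a,a,b,c] e)"
  unfolding contains_pattern_def reduction_eq_0012_iff by blast

text \<open>Only the final letter of a pattern can land on an appended entry, which is why words are
  built from the right.\<close>

lemma subseq_snoc_iff:
  "subseq (s @ [c]) (p @ [d]) \<longleftrightarrow> subseq (s @ [c]) p \<or> c = d \<and> subseq s p"
proof
  assume "subseq (s @ [c]) (p @ [d])"
  then obtain s1 s2 where "s @ [c] = s1 @ s2" "subseq s1 p" "subseq s2 [d]"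
    by (auto simp: subseq_append_iff)
  moreover from this have "length s2 \<le> 1"
    using list_emb_length by fastforce
  ultimately show "subseq (s @ [c]) p \<or> c = d \<and> subseq s p"
    by (cases s2 rule: rev_cases) auto
next
  assume "subseq (s @ [c]) p \<or> c = d \<and> subseq s p"
  then show "subseq (s @ [c]) (p @ [d])"
    by (auto intro: list_emb_append2 list_emb_append_mono)
qed

lemma subseq_pair_iff_repeated: "subseq [a,a] e \<longleftrightarrow> a \<in> repeated_values e"
proof (induction e rule: rev_induct)
  case Nil
  show ?case by (simp add: repeated_values_def)
next
  case (snoc d p)
  have "a \<in> set p \<longleftrightarrow> count_list p a > 0"
    using count_list_0_iff[of p a] by auto
  then show ?case
    using snoc subseq_snoc_iff[of "[a]" a p d]
    by (auto simp: repeated_values_def subseq_singleton_left)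
qed

lemma repeated_values_subset: "repeated_values e \<subseteq> set e"
  unfolding repeated_values_def using count_list_0_iff[of e] by force

lemma finite_repeated_values [simp]: "finite (repeated_values e)"
  using repeated_values_subset finite_subset by blast

lemma repeated_values_snoc:
  "repeated_values (e @ [k]) = repeated_values e \<union> (if k \<in> set e then {k} else {})"
proof -
  have "a \<in> set e \<longleftrightarrow> count_list e a > 0" for a
    using count_list_0_iff[of e a] by auto
  then show ?thesis
    by (auto simp: repeated_values_def)
qed

lemma repeated_values_upt [simp]: "repeated_values [0..<n] = {}"
  by (induction n) (auto simp: repeated_values_snoc, simp add: repeated_values_def)

section \<open>Inversion sequences avoiding \<open>001\<close>\<close>

lemma inversion_seq_snoc:
  "inversion_seq (e @ [k]) \<longleftrightarrow> inversion_seq e \<and> k \<le> length e"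
  by (auto simp: inversion_seq_def nth_append less_Suc_eq)

lemma inversion_seq_less_length:
  "inversion_seq e \<Longrightarrow> v \<in> set e \<Longrightarrow> v < length e"
  unfolding inversion_seq_def in_set_conv_nth by force

definition I001 :: "nat \<Rightarrow> nat list set" where
  "I001 n = {e. length e = n \<and> inversion_seq e \<and> (\<forall>a b. subseq [a,a,b] e \<longrightarrow> b \<le> a)}"

lemma snoc_mem_I001_iff:
  "e @ [k] \<in> I001 (Suc n) \<longleftrightarrow> e \<in> I001 n \<and> k \<le> n \<and> (\<forall>a \<in> repeated_values e. k \<le> a)"
  using subseq_snoc_iff[of "[a,a]" b e k for a b]
  by (auto simp: I001_def inversion_seq_snoc subseq_pair_iff_repeated)

lemma upt_mem_I001: "[0..<n] \<in> I001 n"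
proof (induction n)
  case 0
  show ?case by (simp add: I001_def inversion_seq_def)
next
  case (Suc n)
  then show ?case
    using snoc_mem_I001_iff[of "[0..<n]" n n] by simp
qed

text \<open>The second claim carries the induction: an appended entry is at most the smallest
  repeated value, so it already occurs, and repeating it makes it the new minimum.\<close>

lemma I001_repeated_values:
  assumes "e \<in> I001 n" "e \<noteq> [0..<n]"
  shows "repeated_values e \<noteq> {}" "{..Min (repeated_values e)} \<subseteq> set e"
proof -
  have "repeated_values e \<noteq> {} \<and> {..Min (repeated_values e)} \<subseteq> set e"
    using assms
  proof (induction n arbitrary: e)
    case 0
    then show ?case by (simp add: I001_def)
  next
    case (Suc n)
    from Suc.prems(1) obtain p k where e: "e = p @ [k]"
      by (cases e rule: rev_cases) (auto simp: I001_def)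
    have p: "p \<in> I001 n" "k \<le> n" "\<forall>a \<in> repeated_values p. k \<le> a"
      using Suc.prems(1) by (simp_all add: e snoc_mem_I001_iff)
    show ?case
    proof (cases "p = [0..<n]")
      case True
      \<comment> \<open>\<open>k = n\<close> would give the excluded word
        \<open>[0..<Suc n]\<close>, so \<open>k\<close> is the first repetition.\<close>
      with Suc.prems(2) p(2) have "k < n" by (auto simp: e)
      then show ?thesis by (auto simp: e True repeated_values_snoc)
    next
      case False
      note IH = Suc.IH[OF p(1) False]
      then have "Min (repeated_values p) \<in> repeated_values p" by (simp add: Min_in)
      then have "k \<le> Min (repeated_values p)" using p(3) by blast
      with IH have "{..k} \<subseteq> set p" by (meson atMost_subset_iff subset_trans)
      moreover from this have "Min (repeated_values e) = k"
        using p(3) by (intro Min_eqI) (auto simp: e repeated_values_snoc)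
      ultimately show ?thesis by (auto simp: e repeated_values_snoc)
    qed
  qed
  then show "repeated_values e \<noteq> {}" "{..Min (repeated_values e)} \<subseteq> set e" by auto
qed

section \<open>Classes by smallest repeated value and their recurrence\<close>

text \<open>
  Indexing the prefix \<open>p\<close> by \<open>srpt (p @ [n])\<close> gives \<open>01\<cdots>(n - 1)\<close> the index \<open>n\<close>; with \<open>srpt p\<close> it would
  get \<open>n - 1\<close> and break the recurrence.
\<close>

definition T :: "nat \<Rightarrow> nat \<Rightarrow> nat list set" where
  "T n k = {p \<in> I001 n. srpt (p @ [n]) = k}"

text \<open>The entries of \<open>p\<close> lie below \<open>n\<close>, so the appended
  \<open>n\<close> creates no repetition.\<close>

lemma srpt_snoc_length:
  assumes "p \<in> I001 n"
  shows "srpt (p @ [n]) = (if p = [0..<n] then n else Min (repeated_values p))"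
proof -
  have l: "length p = n" and "n \<notin> set p"
    using assms inversion_seq_less_length[of p n] by (auto simp: I001_def)
  then show ?thesis
    by (auto simp: srpt_def repeated_values_snoc)
qed

lemma T_self: "T n n = {[0..<n]}"
proof -
  have neq: "Min (repeated_values p) \<noteq> n" if "p \<in> I001 n" "p \<noteq> [0..<n]" for p
  proof -
    have "Min (repeated_values p) \<in> set p"
      using I001_repeated_values(2)[OF that] by auto
    then show ?thesis
      using that(1) inversion_seq_less_length[of p] by (force simp: I001_def)
  qed
  have "p \<in> T n n \<longleftrightarrow> p = [0..<n]" for p
    using neq[of p] upt_mem_I001[of n] by (auto simp: T_def srpt_snoc_length split: if_splits)
  then show ?thesis by auto
qed

text \<open>An appended entry that keeps \<open>001\<close> avoided is at most the old index
  \<open>j\<close>, so it already occurs and becomes the new index. The one exception,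
  \<open>n\<close> appended to \<open>[0..<n]\<close>, is excluded on the right by
  \<open>k < n\<close>.\<close>

lemma snoc_mem_T_iff:
  "p @ [v] \<in> T (Suc n) k \<and> p @ [v] \<noteq> [0..<Suc n] \<longleftrightarrow> v = k \<and> k < n \<and> (\<exists>j \<in> {k..n}. p \<in> T n j)"
proof (cases "p \<in> I001 n")
  case False
  then show ?thesis by (auto simp: T_def snoc_mem_I001_iff)
next
  case p: True
  show ?thesis
  proof (cases "p = [0..<n]")
    case True
    have 1: "p @ [v] \<in> I001 (Suc n) \<longleftrightarrow> v \<le> n"
      using p True by (simp add: snoc_mem_I001_iff)
    have 2: "srpt ((p @ [v]) @ [Suc n]) = v" if "v < n"
      using 1 that True by (subst srpt_snoc_length) (auto simp: repeated_values_snoc)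
    have "srpt (p @ [n]) = n"
      using p True by (simp add: srpt_snoc_length)
    then have "(\<exists>j\<in>{k..n}. p \<in> T n j) \<longleftrightarrow> k \<le> n"
      using p by (auto simp: T_def)
    moreover have "p @ [v] \<noteq> [0..<Suc n] \<longleftrightarrow> v \<noteq> n"
      using True by auto
    moreover have "p @ [v] \<in> T (Suc n) k \<longleftrightarrow> v = k" if "v < n"
      using 1 2 that by (auto simp: T_def)
    moreover have "p @ [v] \<notin> T (Suc n) k" if "v > n"
      using 1 that by (auto simp: T_def)
    ultimately show ?thesis
      by (cases v n rule: linorder_cases) auto
  next
    case False
    define m where "m = Min (repeated_values p)"
    have m: "m \<in> repeated_values p" "\<And>a. a \<in> repeated_values p \<Longrightarrow> m \<le> a" "{..m} \<subseteq> set p"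
      using I001_repeated_values[OF p False] by (auto simp: m_def Min_in)
    have "m \<in> set p" using m(3) by auto
    then have "m < n"
      using p inversion_seq_less_length by (auto simp: I001_def)
    have 1: "p @ [v] \<in> I001 (Suc n) \<longleftrightarrow> v \<le> m"
      using p m(1,2) \<open>m < n\<close> by (auto simp: snoc_mem_I001_iff intro: order_trans)
    have 2: "srpt ((p @ [v]) @ [Suc n]) = v" if "v \<le> m"
    proof -
      have "p @ [v] \<in> I001 (Suc n)" using 1 that by simp
      moreover have "Min (repeated_values (p @ [v])) = v"
        using that m by (intro Min_eqI) (auto simp: repeated_values_snoc intro: order_trans)
      ultimately show ?thesis
        using False by (subst srpt_snoc_length) auto
    qed
    have "srpt (p @ [n]) = m"
      using p False by (simp add: srpt_snoc_length m_def)
    then show ?thesis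
      using 1 2 p False \<open>m < n\<close> by (auto simp: T_def)
  qed
qed

text \<open>The class for \<open>k = n\<close> is empty: \<open>n\<close> can only be appended to
  \<open>[0..<n]\<close>, and the result has index \<open>Suc n\<close>.\<close>

lemma T_Suc:
  assumes "k \<le> n"
  shows "T (Suc n) k = (if k < n then (\<lambda>p. p @ [k]) ` (\<Union>j\<in>{k..n}. T n j) else {})"
proof -
  have "[0..<Suc n] \<notin> T (Suc n) k"
    using srpt_snoc_length[OF upt_mem_I001[of "Suc n"]] assms by (simp add: T_def)
  moreover have "\<exists>p v. e = p @ [v]" if "e \<in> T (Suc n) k" for e
    using that by (cases e rule: rev_cases) (auto simp: T_def I001_def)
  ultimately have "e \<in> T (Suc n) k \<longleftrightarrow>
      (\<exists>p. e = p @ [k] \<and> k < n \<and> (\<exists>j\<in>{k..n}. p \<in> T n j))" for e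
    using snoc_mem_T_iff by metis
  then show ?thesis by (auto 4 4)
qed

section \<open>Sizes of the classes\<close>

text \<open>The coefficients 1, 0, 1, 2, 4, 8, ... of (1 - q)^2 / (1 - 2q); the 0 is the size of the
  empty class \<open>T (Suc n) n\<close>.\<close>

definition c :: "nat \<Rightarrow> nat" where
  "c m = (if m = 0 then 1 else if m = 1 then 0 else 2 ^ (m - 2))"

text \<open>Each new term equals the partial sum before it, so the sum doubles. The sum of
  \<open>c 0\<close> alone is left out, as it differs from \<open>c 1\<close>.\<close>

lemma sum_c: "(\<Sum>i\<le>Suc m. c i) = c (Suc (Suc m))"
proof (induction m)
  case 0
  show ?case by (simp add: c_def)
next
  case (Suc m)
  then have "(\<Sum>i\<le>Suc (Suc m). c i) = c (Suc (Suc m)) + c (Suc (Suc m))"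
    by (subst sum.atMost_Suc) (simp only:)
  also have "\<dots> = c (Suc (Suc (Suc m)))" by (simp add: c_def)
  finally show ?case .
qed

lemma card_T: "k \<le> n \<Longrightarrow> finite (T n k) \<and> card (T n k) = c (n - k)"
proof (induction n arbitrary: k)
  case 0
  then show ?case using T_self[of 0] by (simp add: c_def)
next
  case (Suc n)
  consider "k = Suc n" | "k = n" | "k < n" using Suc.prems by linarith
  then show ?case
  proof cases
    case 1
    then show ?thesis using T_self[of "Suc n"] by (simp add: c_def)
  next
    case 2
    then show ?thesis by (simp add: T_Suc c_def)
  next
    case 3
    \<comment> \<open>\<open>sum_c\<close> requires the terms \<open>c 0\<close> and
      \<open>c 1\<close>; they come from \<open>j = n\<close> and \<open>j = n - 1\<close>.\<close>
    then obtain m where m: "n = k + Suc m"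
      using less_imp_Suc_add by auto
    have "card (T (Suc n) k) = card (\<Union>j\<in>{k..n}. T n j)"
      using 3 by (simp add: T_Suc card_image inj_on_def)
    also have "\<dots> = (\<Sum>j\<in>{k..n}. card (T n j))"
      using Suc.IH by (intro card_UN_disjoint) (auto simp: T_def)
    also have "\<dots> = (\<Sum>j\<in>{k..n}. c (n - j))"
      using Suc.IH by simp
    also have "\<dots> = (\<Sum>i\<le>Suc m. c i)"
      by (rule sum.reindex_bij_witness[of _ "\<lambda>i. n - i" "\<lambda>j. n - j"]) (auto simp: m)
    also have "\<dots> = c (Suc n - k)"
      by (simp only: sum_c) (simp add: m)
    finally show ?thesis
      using Suc.IH 3 by (simp add: T_Suc)
  qed
qed

lemma snoc_mem_I0012_iff: "p @ [n] \<in> I0012 (Suc n) \<longleftrightarrow> p \<in> I001 n"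
proof (cases "length p = n \<and> inversion_seq p")
  case False
  then show ?thesis by (auto simp: I0012_def I001_def inversion_seq_snoc)
next
  case True
  have less: "b < n" if "subseq [a,a,b] p" for a b
    using True inversion_seq_less_length list_emb_set[OF that, of b] by auto
  \<comment> \<open>An occurrence of \<open>0012\<close> inside \<open>p\<close> already contains a
    \<open>001\<close> there, so both alternatives of \<open>subseq_snoc_iff\<close> lead to the
    same condition.\<close>
  have "subseq [a,a,b] p" if "subseq [a,a,b,c] p" for a b c
    using that by (auto intro: subseq_order.trans[rotated])
  then have "contains_pattern (p @ [n]) [0,0,1,2] \<longleftrightarrow> (\<exists>a b. a < b \<and> subseq [a,a,b] p)"
    using less subseq_snoc_iff[of "[a,a,b]" c p n for a b c]
    unfolding contains_0012_iff by (simp, blast)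
  then show ?thesis
    using True by (auto simp: I0012_def I001_def inversion_seq_snoc not_less)
qed

lemma f_last_eq:
  assumes "k \<le> n"
  shows "f (Suc n) k n = c (n - k)"
proof -
  have "e \<in> I0012 (Suc n) \<and> srpt e = k \<and> last e = n \<longleftrightarrow> e \<in> (\<lambda>p. p @ [n]) ` T n k" for e
  proof (cases e rule: rev_cases)
    case Nil
    then show ?thesis by (auto simp: I0012_def)
  next
    case (snoc p v)
    then show ?thesis
      using snoc_mem_I0012_iff[of p n] by (auto simp: T_def)
  qed
  then have "{e \<in> I0012 (Suc n). srpt e = k \<and> last e = n} = (\<lambda>p. p @ [n]) ` T n k"
    by blast
  then have "f (Suc n) k n = card (T n k)"
    by (simp add: f_def card_image inj_on_def)
  then show ?thesis using card_T[OF assms] by simp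
qed

section \<open>Generating functions\<close>

lemma fps_c_mult:
  "Abs_fps (\<lambda>m. of_nat (c m)) * (1 - 2 * fps_X) = (1 - fps_X :: 'a :: field fps)\<^sup>2"
proof (rule fps_ext)
  fix m
  let ?C = "Abs_fps (\<lambda>m. of_nat (c m)) :: 'a fps"
  have C: "?C * (1 - 2 * fps_X) = ?C - fps_const 2 * (fps_X * ?C)"
    by (simp add: algebra_simps numeral_fps_const)
  have X: "(1 - fps_X :: 'a fps)\<^sup>2 = 1 - fps_const 2 * fps_X + fps_X ^ 2"
    by (simp add: power2_eq_square algebra_simps numeral_fps_const)
  \<comment> \<open>The numerator lives in degrees 0 to 2; from degree 3 on,
    \<open>c m = 2 * c (m - 1)\<close> makes the left side vanish.\<close>
  consider "m = 0" | "m = 1" | "m = 2" | j where "m = Suc (Suc (Suc j))"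
    by (metis One_nat_def Suc_1 not0_implies_Suc)
  then show "fps_nth (?C * (1 - 2 * fps_X)) m = fps_nth ((1 - fps_X)\<^sup>2) m"
    unfolding C X by cases (auto simp: c_def fps_X_power_nth)
qed

lemma fps_geometric_mult:
  "Abs_fps (\<lambda>n. x ^ n) * (1 - fps_const x * fps_X) = (1 :: 'a :: field fps)"
proof (rule fps_ext)
  fix n
  let ?G = "Abs_fps (\<lambda>n. x ^ n) :: 'a fps"
  have "?G * (1 - fps_const x * fps_X) = ?G - fps_const x * (fps_X * ?G)"
    by (simp add: algebra_simps)
  then show "fps_nth (?G * (1 - fps_const x * fps_X)) n = fps_nth 1 n"
    by (cases n) auto
qed

text \<open>The counts depend only on \<open>n - k\<close>, so each coefficient is a Cauchy product;
  the factor \<open>fps_X\<close> accounts for the final entry of the sequence.\<close>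

lemma L_eq: "L x = fps_X * (Abs_fps (\<lambda>n. x ^ n) * Abs_fps (\<lambda>m. of_nat (c m)))"
proof (rule fps_ext)
  fix n
  have "fps_nth (Abs_fps (\<lambda>n. x ^ n) * Abs_fps (\<lambda>m. of_nat (c m))) m =
      (\<Sum>k = 0..m. of_nat (f (Suc m) k m) * x ^ k)" for m
    by (simp add: fps_mult_nth f_last_eq mult.commute)
  then show "fps_nth (L x) n = fps_nth (fps_X * (Abs_fps (\<lambda>n. x ^ n) * Abs_fps (\<lambda>m. of_nat (c m)))) n"
    by (cases n) (simp_all add: L_def)
qed

theorem theorem4p1:
  fixes x :: "'a :: field"
  shows "L x = fps_X * (1 - fps_X)\<^sup>2 / ((1 - 2 * fps_X) * (1 - fps_const x * fps_X))"
proof -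
  let ?d = "(1 - 2 * fps_X) * (1 - fps_const x * fps_X) :: 'a fps"
  let ?C = "Abs_fps (\<lambda>m. of_nat (c m)) :: 'a fps"
  let ?G = "Abs_fps (\<lambda>n. x ^ n) :: 'a fps"
  have "L x * ?d = fps_X * (?C * (1 - 2 * fps_X)) * (?G * (1 - fps_const x * fps_X))"
    by (simp add: L_eq mult_ac)
  then have "L x * ?d = fps_X * (1 - fps_X)\<^sup>2"
    by (simp only: fps_c_mult fps_geometric_mult mult_1_right)
  \<comment> \<open>The constant term is 1 in every characteristic, so the denominator is nonzero
    and can be cancelled.\<close>
  moreover have "fps_nth ?d 0 = 1"
    by (simp add: fps_mult_nth_0)
  then have "?d \<noteq> 0" by (metis fps_zero_nth zero_neq_one)
  ultimately show ?thesis
    by (metis nonzero_mult_div_cancel_right)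
qed

end
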